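(* Let $A=\{v_1,v_2,\dots,v_n\}$ be a set of $n\ge 1$ distinct integers, and let $Y_1, Y_2, Y_3$ be independent random variables, each uniformly distributed on $A$. Then, setting $Y=Y_1+Y_2+Y_3$, $$\max_{x\in \mathbb{Z}} \mathbb{P}[Y=x]\leq\frac{3+1/n^2}{4n}.$$ *)

theory Defs
  imports "HOL-Probability.Probability"
begin

end

theory Submission
  imports Defs
begin

text \<open>
  Writing \<open>C = x - A\<close>, the number of triples with sum \<open>x\<close> is the number of pairs in \<open>A \<times> A\<close> whose
  sum lies in \<open>C\<close>. Ordering \<open>A\<close>, the grid \<open>A \<times> A\<close> splits into hook-shaped chains of sizes
  \<open>2n - 1, 2n - 3, \<dots>, 1\<close> along which the sum is strictly increasing. Hence a chain of size
  \<open>2i + 1\<close> contains at most \<open>min n (2i + 1)\<close> of the pairs, and adding up these bounds gives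
  \<open>(3n\<^sup>2 + 1) / 4\<close>.
\<close>

text \<open>The hook consists of the column over the least \<open>a\<close> and the row at the
  greatest \<open>b\<close>. Moving up the column and then right along the row, the sum strictly
  increases, so each value in \<open>C\<close> is hit at most once. The other bound is the size of
  the hook, whose arms meet only in \<open>(a, b)\<close>.\<close>

lemma card_hook_sum_mem_le:
  fixes A B C :: "'a::linordered_ab_group_add set"
  assumes "finite A" "finite B" "finite C" "a \<in> A" "b \<in> B"
    and min: "\<And>a'. a' \<in> A \<Longrightarrow> a \<le> a'" and max: "\<And>b'. b' \<in> B \<Longrightarrow> b' \<le> b"
  shows "card {p \<in> {a} \<times> B \<union> A \<times> {b}. fst p + snd p \<in> C}
           \<le> min (card C) (card A + card B - 1)"
    (is "card ?H \<le> _")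
proof -
  have "inj_on (\<lambda>p. fst p + snd p) ({a} \<times> B \<union> A \<times> {b})"
  proof (rule inj_onI)
    \<comment> \<open>A point of the column lies componentwise below every point of the row, so
      equal sums force equality in both coordinates. For two points on the same arm, cancellation
      suffices.\<close>
    have eq: "p = q" if "p \<in> {a} \<times> B" "q \<in> A \<times> {b}" "fst p + snd p = fst q + snd q" for p q
    proof -
      have "fst p \<le> fst q" "snd p \<le> snd q" using that min max by auto
      with that(3) show ?thesis
        by (metis add_le_less_mono add_less_le_mono order_le_less order_less_irrefl prod_eq_iff)
    qed
    fix p q assume "p \<in> {a} \<times> B \<union> A \<times> {b}" "q \<in> {a} \<times> B \<union> A \<times> {b}"
      "fst p + snd p = fst q + snd q"
    then show "p = q" using eq[of p q] eq[of q p] by auto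
  qed
  then have "inj_on (\<lambda>p. fst p + snd p) ?H"
    by (rule inj_on_subset) auto
  then have 1: "card ?H \<le> card C"
    by (rule card_inj_on_le) (use assms in auto)
  have "card ({a} \<times> B \<union> A \<times> {b}) + card ({a} \<times> B \<inter> A \<times> {b}) = card A + card B"
    using card_Un_Int[of "{a} \<times> B" "A \<times> {b}"] assms by (simp add: card_cartesian_product)
  moreover have "{a} \<times> B \<inter> A \<times> {b} = {(a, b)}" using assms by auto
  ultimately have "card ({a} \<times> B \<union> A \<times> {b}) = card A + card B - 1" by simp
  moreover have "card ?H \<le> card ({a} \<times> B \<union> A \<times> {b})"
    by (rule card_mono) (use assms in auto)
  ultimately show ?thesis using 1 by simp
qed

text \<open>Induction peels off one hook at a time, with \<open>C\<close> kept fixed. Two sets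
  \<open>A\<close> and \<open>B\<close> are needed even when starting from a square
  \<open>A \<times> A\<close>: each step removes the minimum of one side but the maximum of the
  other.\<close>

lemma card_sum_mem_le_sum_min:
  fixes A B C :: "'a::linordered_ab_group_add set"
  assumes "finite A" "finite B" "finite C" "card A = k" "card B = k"
  shows "card {p \<in> A \<times> B. fst p + snd p \<in> C} \<le> (\<Sum>i<k. min (card C) (2 * i + 1))"
  using assms
proof (induction k arbitrary: A B)
  case 0
  then show ?case by simp
next
  case (Suc k)
  then have ne: "A \<noteq> {}" "B \<noteq> {}" by auto
  define a b where "a = Min A" and "b = Max B"
  have ab: "a \<in> A" "b \<in> B" using Suc.prems ne by (auto simp: a_def b_def)
  let ?H = "{p \<in> {a} \<times> B \<union> A \<times> {b}. fst p + snd p \<in> C}"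
  let ?R = "{p \<in> (A - {a}) \<times> (B - {b}). fst p + snd p \<in> C}"
  have "card ?H \<le> min (card C) (card A + card B - 1)"
    by (rule card_hook_sum_mem_le) (use Suc.prems ab in \<open>auto simp: a_def b_def\<close>)
  moreover have "card ?R \<le> (\<Sum>i<k. min (card C) (2 * i + 1))"
    by (rule Suc.IH) (use Suc.prems ab in auto)
  moreover have "card A + card B - 1 = 2 * k + 1"
    using Suc.prems by simp
  ultimately have "card ?H + card ?R \<le> (\<Sum>i<Suc k. min (card C) (2 * i + 1))"
    unfolding sum.lessThan_Suc by linarith
  moreover have "{p \<in> A \<times> B. fst p + snd p \<in> C} = ?H \<union> ?R"
    using ab by auto
  ultimately show ?case
    using card_Un_le[of ?H ?R] by simp
qed

text \<open>The odd number \<open>2 * i + 1\<close> reaches \<open>n\<close> at about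
  \<open>i = n div 2\<close>, so the sum is split there, with \<open>2 * i + 1\<close> as the bound
  before and \<open>n\<close> after. For odd \<open>n\<close> the resulting estimate is an equality,
  which is the source of the \<open>+ 1\<close>.\<close>

lemma sum_min_odd_le: "4 * (\<Sum>i<n. min n (2 * i + 1)) \<le> 3 * n\<^sup>2 + (1::nat)"
proof -
  define h where "h = n div 2"
  have "(\<Sum>i<n. min n (2 * i + 1)) = (\<Sum>i<h. min n (2 * i + 1)) + (\<Sum>i=h..<n. min n (2 * i + 1))"
    by (metis atLeast0LessThan h_def div_le_dividend le0 sum.atLeastLessThan_concat)
  also have "\<dots> \<le> (\<Sum>i<h. 2 * i + 1) + (\<Sum>i=h..<n. n)"
    by (intro add_mono sum_mono) auto
  also have "(\<Sum>i<h. 2 * i + 1) = h\<^sup>2"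
    by (induction h) (auto simp: power2_eq_square)
  finally have le: "(\<Sum>i<n. min n (2 * i + 1)) \<le> h\<^sup>2 + (n - h) * n" by simp
  have "4 * (h\<^sup>2 + (n - h) * n) \<le> 3 * n\<^sup>2 + 1"
  proof (cases "even n")
    case True
    then have "n = 2 * h" by (simp add: h_def)
    then show ?thesis by (simp add: power2_eq_square)
  next
    case False
    then have n: "n = 2 * h + 1" by (simp add: h_def)
    then have "n - h = h + 1" by simp
    then show ?thesis by (simp add: n power2_eq_square algebra_simps)
  qed
  then show ?thesis by (rule order_trans[OF mult_le_mono2[OF le]])
qed

text \<open>A triple with sum \<open>x\<close> is encoded by its first two entries, which determine
  the third. The reflection of \<open>A\<close> through \<open>x\<close> has the same cardinality as
  \<open>A\<close>.\<close>

lemma card_sum3_eq_le: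
  fixes A :: "'a::linordered_ab_group_add set"
  assumes "finite A"
  shows "4 * card {p \<in> A \<times> A. x - fst p - snd p \<in> A} \<le> 3 * (card A)\<^sup>2 + 1"
proof -
  have "x - u - v \<in> A \<longleftrightarrow> u + v \<in> (\<lambda>c. x - c) ` A" for u v
    by (metis (no_types, lifting) diff_diff_eq diff_diff_eq2 add_diff_cancel_left' image_iff)
  moreover have "card ((\<lambda>c. x - c) ` A) = card A"
    by (intro card_image inj_onI) simp
  ultimately have "card {p \<in> A \<times> A. x - fst p - snd p \<in> A} \<le> (\<Sum>i<card A. min (card A) (2 * i + 1))"
    using card_sum_mem_le_sum_min[of A A "(\<lambda>c. x - c) ` A" "card A"] assms by simp
  with sum_min_odd_le[of "card A"] show ?thesis by linarith
qed

text \<open>Union bound over the triples in \<open>A\<close> with sum \<open>x\<close>, each of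
  which has probability \<open>1 / card A ^ 3\<close> by independence.\<close>

lemma (in prob_space) prob_sum3_uniform_le:
  fixes Y :: "nat \<Rightarrow> 'a \<Rightarrow> int"
  assumes A: "finite A" "A \<noteq> {}"
    and ind: "indep_vars (\<lambda>_. count_space UNIV) Y {1, 2, 3}"
    and distr: "\<And>i. i \<in> {1, 2, 3} \<Longrightarrow> distr M (count_space UNIV) (Y i) = measure_pmf (pmf_of_set A)"
  shows "\<P>(\<omega> in M. Y 1 \<omega> + Y 2 \<omega> + Y 3 \<omega> = x)
           \<le> card {p \<in> A \<times> A. x - fst p - snd p \<in> A} / card A ^ 3"
proof -
  let ?P = "{p \<in> A \<times> A. x - fst p - snd p \<in> A}"
  have meas: "Y i \<in> measurable M (count_space UNIV)" if "i \<in> {1, 2, 3}" for i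
    using ind that by (auto simp: indep_vars_def)
  note [measurable] = meas[of 1, simplified] meas[of 2, simplified] meas[of 3, simplified]
  \<comment> \<open>The distribution determines the values only up to a null set, so the covering by
    the events \<open>F p\<close> below holds almost everywhere.\<close>
  have AE: "AE \<omega> in M. Y i \<omega> \<in> A" if "i \<in> {1, 2, 3}" for i
  proof -
    have "AE y in distr M (count_space UNIV) (Y i). y \<in> A"
      unfolding distr[OF that] using A by (simp add: AE_measure_pmf_iff)
    then show ?thesis using meas[OF that] by (simp add: AE_distr_iff)
  qed
  have point: "prob (Y i -` {c} \<inter> space M) = 1 / card A" if "i \<in> {1, 2, 3}" "c \<in> A" for i c
  proof -
    have "prob (Y i -` {c} \<inter> space M) = measure (distr M (count_space UNIV) (Y i)) {c}"
      using meas[OF that(1)] by (simp add: measure_distr)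
    also have "\<dots> = 1 / card A"
      unfolding distr[OF that(1)] using A that(2) by (simp add: measure_pmf_single)
    finally show ?thesis .
  qed
  \<comment> \<open>\<open>t p i\<close> is the value that the triple encoded by \<open>p\<close>
    prescribes for \<open>Y i\<close>, and \<open>F p\<close> is the event that all three values
    occur.\<close>
  define t where "t = (\<lambda>(p::int \<times> int) (i::nat). if i = 1 then fst p else if i = 2 then snd p else x - fst p - snd p)"
  define F where "F = (\<lambda>p. \<Inter>i\<in>{1, 2, 3}. Y i -` {t p i} \<inter> space M)"
  have F_sets: "F p \<in> events" for p
    unfolding F_def by (rule sets.finite_INT) (auto intro!: measurable_sets[OF meas])
  have F_prob: "prob (F p) = 1 / card A ^ 3" if "p \<in> ?P" for p
  proof -
    have "prob (F p) = (\<Prod>i\<in>{1, 2, 3}. prob (Y i -` {t p i} \<inter> space M))"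
      unfolding F_def by (rule indep_varsD[OF ind]) auto
    also have "\<dots> = (\<Prod>i\<in>{1, 2, 3::nat}. 1 / card A)"
      by (intro prod.cong refl point) (use that in \<open>auto simp: t_def\<close>)
    finally show ?thesis by (simp add: power3_eq_cube)
  qed
  have fin: "finite ?P" using A by simp
  have "\<P>(\<omega> in M. Y 1 \<omega> + Y 2 \<omega> + Y 3 \<omega> = x) \<le> prob (\<Union>p\<in>?P. F p)"
  proof (rule finite_measure_mono_AE)
    show "(\<Union>p\<in>?P. F p) \<in> events" using fin F_sets by (intro sets.finite_UN) auto
    from AE[of 1, simplified] AE[of 2, simplified] AE[of 3, simplified]
    show "AE \<omega> in M. \<omega> \<in> {\<omega> \<in> space M. Y 1 \<omega> + Y 2 \<omega> + Y 3 \<omega> = x} \<longrightarrow> \<omega> \<in> (\<Union>p\<in>?P. F p)"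
    proof eventually_elim
      case (elim \<omega>)
      show ?case
      proof
        assume \<omega>: "\<omega> \<in> {\<omega> \<in> space M. Y 1 \<omega> + Y 2 \<omega> + Y 3 \<omega> = x}"
        then have "x - Y 1 \<omega> - Y 2 \<omega> = Y 3 \<omega>" by simp
        with elim \<omega> have "(Y 1 \<omega>, Y 2 \<omega>) \<in> ?P" "\<omega> \<in> F (Y 1 \<omega>, Y 2 \<omega>)"
          by (auto simp: F_def t_def)
        then show "\<omega> \<in> (\<Union>p\<in>?P. F p)" by blast
      qed
    qed
  qed
  also have "\<dots> \<le> (\<Sum>p\<in>?P. prob (F p))"
    using fin F_sets by (intro finite_measure_subadditive_finite) auto
  also have "\<dots> = card ?P / card A ^ 3"
    using F_prob by simp
  finally show ?thesis .
qed

theorem theorem2p4: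
  fixes M :: "'a measure" and Y :: "nat \<Rightarrow> 'a \<Rightarrow> int" and A :: "int set" and n :: nat
  assumes "prob_space M"
    and "finite A" and "card A = n" and "n \<ge> 1"
    and "prob_space.indep_vars M (\<lambda>_. count_space UNIV) Y {1, 2, 3}"
    and "\<And>i. i \<in> {1, 2, 3} \<Longrightarrow> distr M (count_space UNIV) (Y i) = measure_pmf (pmf_of_set A)"
  shows "(MAX x::int. \<P>(\<omega> in M. Y 1 \<omega> + Y 2 \<omega> + Y 3 \<omega> = x))
           \<le> (3 + 1 / (real n)\<^sup>2) / (4 * real n)"
proof -
  interpret prob_space M by fact
  let ?f = "\<lambda>x. \<P>(\<omega> in M. Y 1 \<omega> + Y 2 \<omega> + Y 3 \<omega> = x)"
  let ?P = "\<lambda>x. {p \<in> A \<times> A. x - fst p - snd p \<in> A}"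
  have "A \<noteq> {}" using assms by auto
  then have le: "?f x \<le> card (?P x) / n ^ 3" for x
    using prob_sum3_uniform_le[of A Y x] assms by simp
  \<comment> \<open>Outside the finite set of threefold sums the probability vanishes, so
    \<open>?f\<close> has finite range.\<close>
  let ?S = "(\<lambda>(a, b, c). a + b + c) ` (A \<times> A \<times> A)"
  have "?f x = 0" if "x \<notin> ?S" for x
  proof -
    have "?P x = {}"
    proof (rule ccontr)
      assume "?P x \<noteq> {}"
      then obtain a b where "a \<in> A" "b \<in> A" "x - a - b \<in> A" by auto
      then have "x \<in> ?S" by (intro image_eqI[of _ _ "(a, b, x - a - b)"]) auto
      with that show False by contradiction
    qed
    with le[of x] have "?f x \<le> 0" by simp
    then show ?thesis by (simp add: measure_le_0_iff)
  qed
  then have "range ?f \<subseteq> insert 0 (?f ` ?S)" by blast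
  \<comment> \<open>\<open>Max\<close> is only meaningful on finite sets.\<close>
  then have fin: "finite (range ?f)"
    by (rule finite_subset) (simp add: \<open>finite A\<close>)
  have "?f x \<le> (3 + 1 / (real n)\<^sup>2) / (4 * real n)" for x
  proof -
    have "real (4 * card (?P x)) \<le> real (3 * n\<^sup>2 + 1)"
      using card_sum3_eq_le[of A x] assms by (simp only: of_nat_le_iff)
    then have "card (?P x) / n ^ 3 \<le> ((3 * (real n)\<^sup>2 + 1) / 4) / n ^ 3"
      by (intro divide_right_mono) auto
    also have "\<dots> = (3 + 1 / (real n)\<^sup>2) / (4 * real n)"
      using assms by (simp add: field_simps power2_eq_square power3_eq_cube)
    finally show ?thesis using le[of x] by linarith
  qed
  with fin show ?thesis by (subst Max_le_iff) auto
qed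

end
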